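(* Let $\mathbf{L}\in\{\mathbf{K},\mathbf{T},\mathbf{K4},\mathbf{S4}\}$ and let $\varphi$ be an $\mathbf{L}^{Horn,\Box}$-formula. (1) If $\mathbf{L}=\mathbf{K}$ (resp. $\mathbf{L}=\mathbf{T}$), then $\varphi$ is $\mathbf{L}$-satisfiable if and only if it is satisfiable in a pre-linear (resp. pre-linear reflexive) model $M$ with $|M|\le md(\varphi)+1$. (2) If $\mathbf{L}=\mathbf{K4}$ (resp. $\mathbf{L}=\mathbf{S4}$), then $\varphi$ is $\mathbf{L}$-satisfiable if and only if it is satisfiable in a pre-linear transitive (resp. pre-linear transitive and reflexive) model $M$ with $|M|\le|\varphi|$.
   Context: Fix a countable set $\mathcal P$ of propositional letters; Kripke models $((W,R),V)$ with $V:W\to2^{\mathcal P}$ and standard modal satisfaction; $|M|$ is the number of worlds of $M$. $\mathbf{K},\mathbf{T},\mathbf{K4},\mathbf{S4}$ are interpreted over all, reflexive, transitive, and reflexive-transitive frames respectively; $\varphi$ is $\mathbf{L}$-satisfiable if it holds at some world of some model over a frame in the class of $\mathbf{L}$. $|\varphi|$ is the number of symbols of $\varphi$ and $md(\varphi)$ its modal depth (maximum nesting of modal operators). Box positive literals: $\lambda::=\top\mid p\mid\Box\lambda$. An $\mathbf{L}^{Horn,\Box}$-formula is a finite conjunction of clauses $\Box^s(\neg\lambda_1\vee\dots\vee\neg\lambda_n\vee\lambda_{n+1}\vee\dots\vee\lambda_{n+m})$ with $s,n\ge0$, $m\le1$, $\lambda_i$ box positive literals. A frame $(W,R)$ is pre-linear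 if there is a unique world $w_0$ (root) with $w_0R^*w$ for all $w\in W$ ($R^*$ the reflexive-transitive closure) and every world has at most one $R$-successor; a pre-linear model is a model on such a frame. Pre-linear reflexive (resp. transitive, transitive and reflexive) models are obtained from pre-linear models by replacing $R$ with its reflexive closure (resp. transitive closure, reflexive-transitive closure). *)

theory Defs
  imports "HOL-Library.Countable" "HOL-Library.Infinite_Typeclass"
begin

datatype 'p fm =
    Bot
  | Top
  | Letter 'p
  | Neg "'p fm"
  | Or "'p fm" "'p fm"
  | And "'p fm" "'p fm"
  | Box "'p fm"
  | Dia "'p fm"

text \<open>Number of symbols: letters, constants and connectives; parentheses are not counted.\<close>

fun symbols :: "'p fm \<Rightarrow> nat" where
  "symbols Bot = 1"
| "symbols Top = 1"
| "symbols (Letter p) = 1"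
| "symbols (Neg \<phi>) = Suc (symbols \<phi>)"
| "symbols (Or \<phi> \<psi>) = Suc (symbols \<phi> + symbols \<psi>)"
| "symbols (And \<phi> \<psi>) = Suc (symbols \<phi> + symbols \<psi>)"
| "symbols (Box \<phi>) = Suc (symbols \<phi>)"
| "symbols (Dia \<phi>) = Suc (symbols \<phi>)"

fun md :: "'p fm \<Rightarrow> nat" where
  "md Bot = 0"
| "md Top = 0"
| "md (Letter p) = 0"
| "md (Neg \<phi>) = md \<phi>"
| "md (Or \<phi> \<psi>) = max (md \<phi>) (md \<psi>)"
| "md (And \<phi> \<psi>) = max (md \<phi>) (md \<psi>)"
| "md (Box \<phi>) = Suc (md \<phi>)"
| "md (Dia \<phi>) = Suc (md \<phi>)"

text \<open>The valuation is total on the type \<open>'w\<close>; only its values on \<open>worlds M\<close> matter.\<close>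

record ('w, 'p) model =
  worlds :: "'w set"
  acc :: "'w rel"
  val :: "'w \<Rightarrow> 'p set"

definition is_frame :: "'w set \<Rightarrow> 'w rel \<Rightarrow> bool" where
  "is_frame W R \<longleftrightarrow> W \<noteq> {} \<and> R \<subseteq> W \<times> W"

fun sat :: "('w, 'p) model \<Rightarrow> 'w \<Rightarrow> 'p fm \<Rightarrow> bool" where
  "sat M w Bot \<longleftrightarrow> False"
| "sat M w Top \<longleftrightarrow> True"
| "sat M w (Letter p) \<longleftrightarrow> p \<in> val M w"
| "sat M w (Neg \<phi>) \<longleftrightarrow> \<not> sat M w \<phi>"
| "sat M w (Or \<phi> \<psi>) \<longleftrightarrow> sat M w \<phi> \<or> sat M w \<psi>"
| "sat M w (And \<phi> \<psi>) \<longleftrightarrow> sat M w \<phi> \<and> sat M w \<psi>"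
| "sat M w (Box \<phi>) \<longleftrightarrow> (\<forall>v\<in>worlds M. (w, v) \<in> acc M \<longrightarrow> sat M v \<phi>)"
| "sat M w (Dia \<phi>) \<longleftrightarrow> (\<exists>v\<in>worlds M. (w, v) \<in> acc M \<and> sat M v \<phi>)"

definition satisfiable_in :: "('w, 'p) model \<Rightarrow> 'p fm \<Rightarrow> bool" where
  "satisfiable_in M \<phi> \<longleftrightarrow> (\<exists>w\<in>worlds M. sat M w \<phi>)"

datatype logic = K | T | K4 | S4

fun frame_class :: "logic \<Rightarrow> 'w set \<Rightarrow> 'w rel \<Rightarrow> bool" where
  "frame_class K W R \<longleftrightarrow> is_frame W R"
| "frame_class T W R \<longleftrightarrow> is_frame W R \<and> refl_on W R"
| "frame_class K4 W R \<longleftrightarrow> is_frame W R \<and> trans R"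
| "frame_class S4 W R \<longleftrightarrow> is_frame W R \<and> refl_on W R \<and> trans R"

text \<open>HOL cannot quantify existentially over types, so the type \<open>'w\<close> from which worlds are
  drawn is a parameter. Satisfiability in the usual sense is \<open>satisfiable TYPE('w)\<close> for some \<open>'w\<close>;
  \<open>'w\<close> can always be taken infinite, since every model is isomorphic to one over an infinite type.\<close>

definition satisfiable :: "'w itself \<Rightarrow> logic \<Rightarrow> 'p fm \<Rightarrow> bool" where
  "satisfiable _ L \<phi> \<longleftrightarrow>
     (\<exists>M :: ('w, 'p) model. frame_class L (worlds M) (acc M) \<and> satisfiable_in M \<phi>)"

definition pre_linear :: "'w set \<Rightarrow> 'w rel \<Rightarrow> bool" where
  "pre_linear W R \<longleftrightarrow> is_frame W R
     \<and> (\<exists>!w0. w0 \<in> W \<and> (\<forall>w\<in>W. (w0, w) \<in> R\<^sup>*))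
     \<and> (\<forall>w\<in>W. \<forall>u v. (w, u) \<in> R \<longrightarrow> (w, v) \<in> R \<longrightarrow> u = v)"

text \<open>Reflexive pairs are added on \<open>W\<close> only (\<open>R\<^sup>*\<close> would add them on the whole type).\<close>

fun closure_for :: "logic \<Rightarrow> 'w set \<Rightarrow> 'w rel \<Rightarrow> 'w rel" where
  "closure_for K W R = R"
| "closure_for T W R = R \<union> Id_on W"
| "closure_for K4 W R = R\<^sup>+"
| "closure_for S4 W R = R\<^sup>+ \<union> Id_on W"

text \<open>\<open>pre_linear_model L M\<close>: \<open>M\<close> is a pre-linear model (\<open>K\<close>), a pre-linear reflexive model (\<open>T\<close>),
  a pre-linear transitive model (\<open>K4\<close>), a pre-linear transitive and reflexive model (\<open>S4\<close>).\<close>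

definition pre_linear_model :: "logic \<Rightarrow> ('w, 'p) model \<Rightarrow> bool" where
  "pre_linear_model L M \<longleftrightarrow>
     (\<exists>R. pre_linear (worlds M) R \<and> acc M = closure_for L (worlds M) R)"

inductive box_positive_literal :: "'p fm \<Rightarrow> bool" where
  "box_positive_literal Top"
| "box_positive_literal (Letter p)"
| "box_positive_literal l \<Longrightarrow> box_positive_literal (Box l)"

text \<open>Finite disjunctions and conjunctions are bracketed to the right; the empty ones are
  \<open>Bot\<close> and \<open>Top\<close>.\<close>

fun disj_list :: "'p fm list \<Rightarrow> 'p fm" where
  "disj_list [] = Bot"
| "disj_list [\<phi>] = \<phi>"
| "disj_list (\<phi> # \<psi> # \<chi>s) = Or \<phi> (disj_list (\<psi> # \<chi>s))"

fun conj_list :: "'p fm list \<Rightarrow> 'p fm" where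
  "conj_list [] = Top"
| "conj_list [\<phi>] = \<phi>"
| "conj_list (\<phi> # \<psi> # \<chi>s) = And \<phi> (conj_list (\<psi> # \<chi>s))"

definition horn_box_clause :: "'p fm \<Rightarrow> bool" where
  "horn_box_clause \<gamma> \<longleftrightarrow>
     (\<exists>s ns ps. (\<forall>l\<in>set (ns @ ps). box_positive_literal l) \<and> length ps \<le> 1
        \<and> \<gamma> = (Box ^^ s) (disj_list (map Neg ns @ ps)))"

definition horn_box_formula :: "'p fm \<Rightarrow> bool" where
  "horn_box_formula \<phi> \<longleftrightarrow> (\<exists>\<gamma>s. (\<forall>\<gamma>\<in>set \<gamma>s. horn_box_clause \<gamma>) \<and> \<phi> = conj_list \<gamma>s)"

end

theory Submission
  imports Defs
begin

text \<open>Let a Horn formula hold at \<open>w\<close>, and let level \<open>k\<close> be the set of worlds reachable from \<open>w\<close> in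
  exactly \<open>k\<close> steps. Collapse each level to a single world carrying the letters true throughout
  the level. A literal \<open>Box^j p\<close> then holds at point \<open>i\<close> of the chain iff \<open>p\<close> holds throughout
  level \<open>i + j\<close>. Since a clause has at most one positive literal and the levels are nonempty, a
  clause that holds throughout a level holds at the corresponding point.

  For \<open>K\<close>, \<open>T\<close> and \<open>S4\<close> the chain can be cut at the modal depth. For \<open>K4\<close> a clause below a box is
  evaluated arbitrarily far down the chain, so the cut must be chosen: at a point \<open>t\<close> such that
  every head \<open>Box^j q\<close> with \<open>q\<close> true throughout level \<open>t + j\<close> has \<open>q\<close> true throughout level \<open>t\<close>
  already; then a reflexive last point can replace all later levels. As levels decrease, each head
  of depth \<open>j\<close> excludes at most \<open>j\<close> values of \<open>t\<close>, so a suitable \<open>t\<close> exists below \<open>symbols \<phi>\<close>.\<close>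

section \<open>Isomorphic copies of models\<close>

text \<open>Chains are built over \<open>nat\<close>, while the theorem speaks of two arbitrary
  infinite types; isomorphic copies carry models between them. On the image, \<open>inv_into\<close>
  recovers the original world whenever \<open>g\<close> is injective on
  \<open>worlds M\<close>.\<close>

definition image_model :: "('a \<Rightarrow> 'b) \<Rightarrow> ('a, 'p) model \<Rightarrow> ('b, 'p) model" where
  "image_model g M = \<lparr>worlds = g ` worlds M, acc = map_prod g g ` acc M,
     val = val M \<circ> inv_into (worlds M) g\<rparr>"

lemma map_prod_mem_iff:
  assumes "inj_on g W" "R \<subseteq> W \<times> W" "x \<in> W" "y \<in> W"
  shows "(g x, g y) \<in> map_prod g g ` R \<longleftrightarrow> (x, y) \<in> R"
proof
  assume "(g x, g y) \<in> map_prod g g ` R"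
  then obtain a b where ab: "(a, b) \<in> R" "g x = g a" "g y = g b" by auto
  then have "a \<in> W" "b \<in> W" using assms(2) by auto
  then show "(x, y) \<in> R" using ab assms(1,3,4) by (metis inj_onD)
qed auto

lemma sat_image_model:
  assumes "inj_on g (worlds M)" "acc M \<subseteq> worlds M \<times> worlds M" "w \<in> worlds M"
  shows "sat (image_model g M) (g w) \<phi> \<longleftrightarrow> sat M w \<phi>"
  using assms(3)
  by (induction \<phi> arbitrary: w)
    (auto simp: image_model_def assms(1) map_prod_mem_iff[OF assms(1,2)] simp del: map_prod_imageI)

text \<open>Injectivity makes consecutive image edges come from consecutive edges: two preimages of
  the shared endpoint must coincide.\<close>

lemma trancl_map_prod:
  assumes "inj_on g W" "R \<subseteq> W \<times> W"
  shows "(map_prod g g ` R)\<^sup>+ = map_prod g g ` R\<^sup>+"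
proof (intro equalityI subrelI)
  fix x y assume "(x, y) \<in> (map_prod g g ` R)\<^sup>+"
  then show "(x, y) \<in> map_prod g g ` R\<^sup>+"
  proof (induction rule: trancl_induct)
    case (base y)
    then show ?case by auto
  next
    case (step y z)
    then obtain a b c d where
      "x = g a" "y = g b" "(a, b) \<in> R\<^sup>+" "y = g c" "z = g d" "(c, d) \<in> R" by auto
    moreover have "b \<in> W" "c \<in> W"
      using calculation trancl_subset_Sigma[OF assms(2)] assms(2) by auto
    ultimately have "x = g a" "z = g d" "(a, d) \<in> R\<^sup>+"
      using assms(1) by (metis inj_onD trancl.trancl_into_trancl)+
    then show ?case by (metis map_prod_imageI)
  qed
next
  fix x y assume "(x, y) \<in> map_prod g g ` R\<^sup>+"
  then obtain a b where "x = g a" "y = g b" "(a, b) \<in> R\<^sup>+" by auto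
  from this(3) have "(g a, g b) \<in> (map_prod g g ` R)\<^sup>+"
    by (induction rule: trancl_induct)
      (auto intro: trancl.trancl_into_trancl simp del: map_prod_imageI dest: map_prod_imageI)
  then show "(x, y) \<in> (map_prod g g ` R)\<^sup>+" using \<open>x = g a\<close> \<open>y = g b\<close> by simp
qed

lemma closure_for_image:
  assumes "inj_on g W" "R \<subseteq> W \<times> W"
  shows "closure_for L (g ` W) (map_prod g g ` R) = map_prod g g ` closure_for L W R"
proof -
  have "Id_on (g ` W) = map_prod g g ` Id_on W" by auto
  then show ?thesis by (cases L) (auto simp: trancl_map_prod[OF assms] image_Un)
qed

lemma pre_linear_image:
  assumes "inj_on g W" "pre_linear W R"
  shows "pre_linear (g ` W) (map_prod g g ` R)"
proof -
  have sub: "R \<subseteq> W \<times> W" and ne: "W \<noteq> {}"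
    using assms(2) by (auto simp: pre_linear_def is_frame_def)
  have rt: "(g x, g y) \<in> (map_prod g g ` R)\<^sup>* \<longleftrightarrow> (x, y) \<in> R\<^sup>*" if "x \<in> W" "y \<in> W" for x y
    unfolding rtrancl_eq_or_trancl trancl_map_prod[OF assms(1) sub]
    using map_prod_mem_iff[OF assms(1) trancl_subset_Sigma[OF sub] that]
      inj_on_eq_iff[OF assms(1) that] by simp
  obtain r where r: "r \<in> W" "\<forall>w\<in>W. (r, w) \<in> R\<^sup>*"
    and r_uniq: "\<And>r'. r' \<in> W \<Longrightarrow> \<forall>w\<in>W. (r', w) \<in> R\<^sup>* \<Longrightarrow> r' = r"
    using assms(2) unfolding pre_linear_def by blast
  have "\<exists>!w0. w0 \<in> g ` W \<and> (\<forall>w\<in>g ` W. (w0, w) \<in> (map_prod g g ` R)\<^sup>*)"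
  proof (rule ex1I[of _ "g r"])
    show "g r \<in> g ` W \<and> (\<forall>w\<in>g ` W. (g r, w) \<in> (map_prod g g ` R)\<^sup>*)"
      using r rt by auto
  next
    fix w assume "w \<in> g ` W \<and> (\<forall>v\<in>g ` W. (w, v) \<in> (map_prod g g ` R)\<^sup>*)"
    then show "w = g r" using rt r_uniq by auto
  qed
  moreover have "\<forall>w\<in>g ` W. \<forall>u v. (w, u) \<in> map_prod g g ` R \<longrightarrow> (w, v) \<in> map_prod g g ` R \<longrightarrow> u = v"
  proof (intro ballI allI impI)
    fix w u v assume "(w, u) \<in> map_prod g g ` R" "(w, v) \<in> map_prod g g ` R"
    then obtain a b c d where *: "(a, b) \<in> R" "(c, d) \<in> R" "g a = g c" "u = g b" "v = g d"
      by auto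
    then have "a = c" using sub assms(1) by (blast dest: inj_onD)
    then show "u = v" using * sub assms(2) unfolding pre_linear_def by blast
  qed
  moreover have "is_frame (g ` W) (map_prod g g ` R)"
    using sub ne by (auto simp: is_frame_def)
  ultimately show ?thesis by (simp add: pre_linear_def)
qed

lemma closure_for_subset: "R \<subseteq> W \<times> W \<Longrightarrow> closure_for L W R \<subseteq> W \<times> W"
  using trancl_subset_Sigma[of R W] by (cases L) auto

lemma pre_linear_model_frame_class:
  assumes "pre_linear_model L M"
  shows "frame_class L (worlds M) (acc M)"
proof -
  obtain R where R: "pre_linear (worlds M) R" "acc M = closure_for L (worlds M) R"
    using assms unfolding pre_linear_model_def by blast
  then have "is_frame (worlds M) R" by (simp add: pre_linear_def)
  then have fr: "is_frame (worlds M) (acc M)"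
    using closure_for_subset[of R "worlds M" L] R(2) by (auto simp: is_frame_def)
  moreover have "trans (R\<^sup>+ \<union> Id_on (worlds M))"
    by (auto simp: trans_def)
  ultimately show ?thesis using R(2)
    by (cases L) (auto simp: refl_on_def is_frame_def)
qed

lemma frame_class_is_frame: "frame_class L W R \<Longrightarrow> is_frame W R"
  by (cases L) auto

lemma pre_linear_model_image:
  assumes "inj_on g (worlds M)" "pre_linear_model L M"
  shows "pre_linear_model L (image_model g M)"
proof -
  obtain R where R: "pre_linear (worlds M) R" "acc M = closure_for L (worlds M) R"
    using assms(2) unfolding pre_linear_model_def by blast
  then have "R \<subseteq> worlds M \<times> worlds M" by (simp add: pre_linear_def is_frame_def)
  then have "acc (image_model g M) =
      closure_for L (worlds (image_model g M)) (map_prod g g ` R)"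
    using closure_for_image[OF assms(1)] R(2) by (simp add: image_model_def)
  moreover have "pre_linear (worlds (image_model g M)) (map_prod g g ` R)"
    using pre_linear_image[OF assms(1) R(1)] by (simp add: image_model_def)
  ultimately show ?thesis unfolding pre_linear_model_def by blast
qed

lemma satisfiable_in_image_model:
  assumes "inj_on g (worlds M)" "acc M \<subseteq> worlds M \<times> worlds M" "satisfiable_in M \<phi>"
  shows "satisfiable_in (image_model g M) \<phi>"
proof -
  obtain w where "w \<in> worlds M" "sat M w \<phi>"
    using assms(3) unfolding satisfiable_in_def by blast
  moreover from this have "g w \<in> worlds (image_model g M)" by (simp add: image_model_def)
  ultimately show ?thesis
    using sat_image_model[OF assms(1,2)] unfolding satisfiable_in_def by blast
qed

text \<open>The converse direction of the theorem: the closure puts a pre-linear frame into the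
  class of \<open>L\<close>, and finitely many worlds fit into any infinite type.\<close>

lemma pre_linear_model_satisfiable:
  fixes M :: "('v, 'p) model"
  assumes "pre_linear_model L M" "finite (worlds M)" "satisfiable_in M \<phi>"
  shows "satisfiable TYPE('w::infinite) L \<phi>"
proof -
  \<comment> \<open>The type \<open>'v\<close> may be larger than \<open>'w\<close>, so the
    injection is taken on the finite set of worlds only.\<close>
  obtain g :: "'v \<Rightarrow> 'w" where g: "inj_on g (worlds M)"
  proof -
    obtain B :: "'w set" where "finite B" "card B = card (worlds M)"
      using infinite_arbitrarily_large[OF infinite_UNIV] by blast
    then show ?thesis using that assms(2) by (metis finite_same_card_bij bij_betw_def)
  qed
  have "acc M \<subseteq> worlds M \<times> worlds M"
    using pre_linear_model_frame_class[OF assms(1)] frame_class_is_frame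
    unfolding is_frame_def by blast
  then show ?thesis
    using pre_linear_model_frame_class[OF pre_linear_model_image[OF g assms(1)]]
      satisfiable_in_image_model[OF g _ assms(3)]
    unfolding satisfiable_def by blast
qed

section \<open>Chains\<close>

text \<open>A loop at the last point keeps the frame pre-linear, because that point has no other
  successor.\<close>

definition chain_rel :: "bool \<Rightarrow> nat \<Rightarrow> nat rel" where
  "chain_rel loop t = {(i, Suc i) | i. i < t} \<union> (if loop then {(t, t)} else {})"

lemma chain_rel_iff:
  "(i, k) \<in> chain_rel loop t \<longleftrightarrow> k = Suc i \<and> i < t \<or> loop \<and> i = t \<and> k = t"
  by (auto simp: chain_rel_def)

lemma chain_rel_subset: "chain_rel loop t \<subseteq> {..t} \<times> {..t}"
  by (auto simp: chain_rel_iff)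

lemma chain_rel_trancl:
  assumes "(i, k) \<in> (chain_rel loop t)\<^sup>+"
  shows "i < k \<and> k \<le> t \<or> loop \<and> i = t \<and> k = t"
  using assms by (induction rule: trancl_induct) (auto simp: chain_rel_iff)

text \<open>Edges never decrease the index, so only \<open>0\<close> reaches \<open>0\<close>; this
  makes the root unique, with or without the loop.\<close>

lemma pre_linear_chain: "pre_linear {..t} (chain_rel loop t)"
proof -
  have reach: "k \<le> t \<Longrightarrow> (0, k) \<in> (chain_rel loop t)\<^sup>*" for k
    by (induction k) (auto simp: chain_rel_iff intro: rtrancl_into_rtrancl)
  have "r = 0" if "r \<le> t" "(r, 0) \<in> (chain_rel loop t)\<^sup>*" for r
    using that chain_rel_trancl[of r 0 loop t] by (auto simp: rtrancl_eq_or_trancl)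
  then have "\<exists>!r. r \<in> {..t} \<and> (\<forall>w\<in>{..t}. (r, w) \<in> (chain_rel loop t)\<^sup>*)"
    using reach by (intro ex1I[of _ 0]) auto
  then show ?thesis
    using chain_rel_subset by (auto simp: pre_linear_def is_frame_def chain_rel_iff)
qed

lemma chain_closure_step:
  assumes "(i, k) \<in> closure_for L {..t} (chain_rel loop t)"
  shows "i \<le> t" "k \<le> t"
    "L = K \<Longrightarrow> k = Suc i \<or> loop \<and> i = t \<and> k = t"
    "L = T \<Longrightarrow> k = Suc i \<or> k = i"
    "L = K4 \<Longrightarrow> i < k \<or> loop \<and> i = t \<and> k = t"
    "L = S4 \<Longrightarrow> i \<le> k"
  using assms closure_for_subset[OF chain_rel_subset[of loop t], of L]
    chain_rel_trancl[of i k loop t]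
  by (auto simp: chain_rel_iff)

text \<open>Locates the points at which a clause under \<open>s\<close> boxes is evaluated, seen
  from the root. In \<open>K4\<close> a path may skip points but falls short of \<open>s\<close>
  only by circling at the reflexive end.\<close>

lemma chain_closure_relpow:
  assumes "(0, i) \<in> closure_for L {..t} (chain_rel loop t) ^^ s"
  shows "i \<le> t" "s = 0 \<Longrightarrow> i = 0"
    "L = K \<Longrightarrow> \<not> loop \<Longrightarrow> i = s" "L = T \<Longrightarrow> i \<le> s" "L = K4 \<Longrightarrow> s \<le> i \<or> loop \<and> i = t"
proof -
  have "i \<le> t \<and> (s = 0 \<longrightarrow> i = 0) \<and> (L = K \<longrightarrow> \<not> loop \<longrightarrow> i = s) \<and> (L = T \<longrightarrow> i \<le> s)
     \<and> (L = K4 \<longrightarrow> s \<le> i \<or> loop \<and> i = t)"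
    using assms
  proof (induction s arbitrary: i)
    case (Suc s)
    then obtain k where k: "(0, k) \<in> closure_for L {..t} (chain_rel loop t) ^^ s"
      "(k, i) \<in> closure_for L {..t} (chain_rel loop t)" by auto
    show ?case using Suc.IH[OF k(1)] chain_closure_step[OF k(2)] by auto
  qed auto
  then show "i \<le> t" "s = 0 \<Longrightarrow> i = 0"
    "L = K \<Longrightarrow> \<not> loop \<Longrightarrow> i = s" "L = T \<Longrightarrow> i \<le> s" "L = K4 \<Longrightarrow> s \<le> i \<or> loop \<and> i = t"
    by auto
qed

section \<open>Horn clauses\<close>

text \<open>Triples keep the box prefix and the head accessible as data, so that prefix lengths and
  head depths can be summed over the clauses.\<close>

definition clause :: "nat \<times> 'p fm list \<times> 'p fm list \<Rightarrow> 'p fm" where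
  "clause c = (case c of (s, ns, ps) \<Rightarrow> (Box ^^ s) (disj_list (map Neg ns @ ps)))"

definition horn_data :: "nat \<times> 'p fm list \<times> 'p fm list \<Rightarrow> bool" where
  "horn_data c = (case c of (s, ns, ps) \<Rightarrow>
     (\<forall>l\<in>set (ns @ ps). box_positive_literal l) \<and> length ps \<le> 1)"

lemma horn_box_formula_data:
  assumes "horn_box_formula \<phi>"
  obtains cs where "\<forall>c\<in>set cs. horn_data c" "\<phi> = conj_list (map clause cs)"
proof -
  obtain \<gamma>s where \<gamma>s: "\<forall>\<gamma>\<in>set \<gamma>s. horn_box_clause \<gamma>" "\<phi> = conj_list \<gamma>s"
    using assms unfolding horn_box_formula_def by blast
  have "\<forall>\<gamma>\<in>set \<gamma>s. \<exists>c. horn_data c \<and> \<gamma> = clause c"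
    using \<gamma>s(1) unfolding horn_box_clause_def horn_data_def clause_def by fastforce
  then obtain f where "\<forall>\<gamma>\<in>set \<gamma>s. horn_data (f \<gamma>) \<and> \<gamma> = clause (f \<gamma>)" by metis
  then have "\<forall>c\<in>set (map f \<gamma>s). horn_data c" "map clause (map f \<gamma>s) = \<gamma>s"
    by (auto intro!: map_idI)
  then show ?thesis using that \<gamma>s(2) by metis
qed

lemma sat_disj_list: "sat M w (disj_list \<phi>s) \<longleftrightarrow> (\<exists>\<phi>\<in>set \<phi>s. sat M w \<phi>)"
  by (induction \<phi>s rule: disj_list.induct) auto

lemma sat_conj_list: "sat M w (conj_list \<phi>s) \<longleftrightarrow> (\<forall>\<phi>\<in>set \<phi>s. sat M w \<phi>)"
  by (induction \<phi>s rule: conj_list.induct) auto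

lemma sat_Box_pow:
  assumes "acc M \<subseteq> worlds M \<times> worlds M"
  shows "sat M w ((Box ^^ s) \<phi>) \<longleftrightarrow> (\<forall>v. (w, v) \<in> acc M ^^ s \<longrightarrow> sat M v \<phi>)"
proof (induction s arbitrary: w)
  case (Suc s)
  have "sat M w ((Box ^^ Suc s) \<phi>) \<longleftrightarrow> (\<forall>u. (w, u) \<in> acc M \<longrightarrow> sat M u ((Box ^^ s) \<phi>))"
    using assms by auto
  also have "\<dots> \<longleftrightarrow> (\<forall>v. (w, v) \<in> acc M O acc M ^^ s \<longrightarrow> sat M v \<phi>)"
    unfolding Suc.IH by blast
  finally show ?case by (simp add: relpow_commute)
qed simp

lemma sat_clause:
  assumes "acc M \<subseteq> worlds M \<times> worlds M"
  shows "sat M w (clause (s, ns, ps)) \<longleftrightarrow>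
    (\<forall>v. (w, v) \<in> acc M ^^ s \<longrightarrow> (\<forall>l\<in>set ns. sat M v l) \<longrightarrow> (\<exists>l\<in>set ps. sat M v l))"
  unfolding clause_def prod.case sat_Box_pow[OF assms] sat_disj_list set_append set_map
  by (auto simp: bex_Un)

section \<open>Modal depth and size of clauses\<close>

lemma md_disj_list: "\<phi> \<in> set \<phi>s \<Longrightarrow> md \<phi> \<le> md (disj_list \<phi>s)"
  by (induction \<phi>s rule: disj_list.induct) (auto simp: max_def)

lemma md_conj_list: "\<phi> \<in> set \<phi>s \<Longrightarrow> md \<phi> \<le> md (conj_list \<phi>s)"
  by (induction \<phi>s rule: conj_list.induct) (auto simp: max_def)

lemma md_Box_pow: "md ((Box ^^ s) \<phi>) = s + md \<phi>"
  by (induction s) auto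

lemma md_clause:
  assumes "l \<in> set ns \<union> set ps"
  shows "s + md l \<le> md (clause (s, ns, ps))"
proof -
  have "md l \<le> md (disj_list (map Neg ns @ ps))"
  proof (cases "l \<in> set ps")
    case False
    then have "Neg l \<in> set (map Neg ns @ ps)" using assms by auto
    then show ?thesis using md_disj_list by fastforce
  qed (simp add: md_disj_list)
  then show ?thesis by (simp add: clause_def md_Box_pow)
qed

lemma md_less_symbols: "md \<phi> < symbols \<phi>"
  by (induction \<phi>) auto

lemma symbols_Box_pow: "symbols ((Box ^^ s) \<phi>) = s + symbols \<phi>"
  by (induction s) auto

text \<open>With at most one head, the sum is the depth of the head or \<open>0\<close>. Strictness
  leaves room for the extra world in the count of a chain.\<close>

lemma symbols_clause:
  assumes "length ps \<le> 1"
  shows "s + (\<Sum>l\<leftarrow>ps. md l) < symbols (clause (s, ns, ps))"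
proof -
  have "(\<Sum>l\<leftarrow>ps. md l) \<le> md (disj_list (map Neg ns @ ps))"
    using assms md_disj_list[of "hd ps" "map Neg ns @ ps"] by (cases ps) auto
  also have "\<dots> < symbols (disj_list (map Neg ns @ ps))" by (rule md_less_symbols)
  finally show ?thesis by (simp add: clause_def symbols_Box_pow)
qed

lemma symbols_conj_list: "(\<Sum>\<phi>\<leftarrow>\<phi>s. symbols \<phi>) \<le> symbols (conj_list \<phi>s)"
  by (induction \<phi>s rule: conj_list.induct) auto

lemma sum_set_le_sum_list:
  fixes f :: "'a \<Rightarrow> nat"
  shows "(\<Sum>x\<in>set xs. f x) \<le> (\<Sum>x\<leftarrow>xs. f x)"
  by (induction xs) (auto simp: sum.insert_if)

text \<open>A box positive literal \<open>l\<close> is \<open>core l\<close> under exactly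
  \<open>md l\<close> boxes.\<close>

fun core :: "'p fm \<Rightarrow> 'p fm" where
  "core (Box l) = core l"
| "core l = l"

section \<open>Collapsing the levels of a model to a chain\<close>

abbreviation level :: "('w, 'p) model \<Rightarrow> 'w \<Rightarrow> nat \<Rightarrow> 'w set" where
  "level M w k \<equiv> (acc M ^^ k) `` {w}"

text \<open>An empty level would make every letter true, so the uses below keep all levels up to
  \<open>t\<close> nonempty.\<close>

definition chain_model :: "logic \<Rightarrow> bool \<Rightarrow> nat \<Rightarrow> ('w, 'p) model \<Rightarrow> 'w \<Rightarrow> (nat, 'p) model" where
  "chain_model L loop t M w = \<lparr>worlds = {..t}, acc = closure_for L {..t} (chain_rel loop t),
     val = \<lambda>k. \<Inter> (val M ` level M w k)\<rparr>"

lemma pre_linear_model_chain: "pre_linear_model L (chain_model L loop t M w)"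
  using pre_linear_chain unfolding pre_linear_model_def chain_model_def by auto

text \<open>Stripping one box moves from a level to the next one, since the successors of a level
  are exactly the next level.\<close>

lemma sat_level_literal:
  assumes "acc M \<subseteq> worlds M \<times> worlds M" "box_positive_literal l"
  shows "(\<forall>v\<in>level M w i. sat M v l) \<longleftrightarrow> (\<forall>v\<in>level M w (i + md l). sat M v (core l))"
  using assms(2)
proof (induction l arbitrary: i)
  case (3 l)
  have "(\<forall>v\<in>level M w i. sat M v (Box l)) \<longleftrightarrow> (\<forall>v\<in>level M w (Suc i). sat M v l)"
    using assms(1) by auto
  then show ?case by (simp only: 3 md.simps core.simps add_Suc add_Suc_right)
qed auto

text \<open>The sequence \<open>S\<close> continues the levels of the chain beyond its last point: by the
  last level if that point is reflexive, by empty levels otherwise.\<close>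

lemma sat_chain_literal:
  assumes "box_positive_literal l" "i \<le> t"
    and agree: "\<And>k. k \<le> t \<Longrightarrow> S k = level M w k"
    and upper: "\<And>i k n. (i, k) \<in> closure_for L {..t} (chain_rel loop t) \<Longrightarrow>
      S (k + n) \<subseteq> S (Suc i + n)"
    and last: "\<And>k. t < k \<Longrightarrow> S k = (if loop then S t else {})"
  shows "sat (chain_model L loop t M w) i l \<longleftrightarrow> (\<forall>v\<in>S (i + md l). sat M v (core l))"
  using assms(1,2)
proof (induction l arbitrary: i)
  case (3 l)
  let ?A = "closure_for L {..t} (chain_rel loop t)"
  let ?P = "\<lambda>k. \<forall>v\<in>S (k + md l). sat M v (core l)"
  have R: "chain_rel loop t \<subseteq> ?A" by (cases L) auto
  have "sat (chain_model L loop t M w) i (Box l) \<longleftrightarrow> (\<forall>k\<le>t. (i, k) \<in> ?A \<longrightarrow> ?P k)"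
    using 3 by (auto simp: chain_model_def)
  \<comment> \<open>The closure may add successors of \<open>i\<close>, but by \<open>upper\<close>
    they impose nothing beyond what holds on \<open>S (Suc i + md l)\<close>.\<close>
  also have "\<dots> \<longleftrightarrow> ?P (Suc i)"
  proof (intro iffI allI impI)
    fix k assume "?P (Suc i)" "(i, k) \<in> ?A"
    then show "?P k" using upper[of i k "md l"] by blast
  next
    assume *: "\<forall>k\<le>t. (i, k) \<in> ?A \<longrightarrow> ?P k"
    \<comment> \<open>Either the next point exists, or the loop replaces it and \<open>S\<close> is
      constant from \<open>t\<close> on, or the point is a dead end and \<open>S\<close> is empty
      beyond it.\<close>
    consider "i < t" | "i = t" loop | "i = t" "\<not> loop" using \<open>i \<le> t\<close> by linarith
    then show "?P (Suc i)"
    proof cases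
      case 1
      then have "(i, Suc i) \<in> ?A" using R by (auto simp: chain_rel_iff)
      then show ?thesis using * 1 Suc_leI by blast
    next
      case 2
      then have "(i, t) \<in> ?A" using R by (auto simp: chain_rel_iff)
      moreover have "S (Suc i + md l) = S (t + md l)"
        using last[of "Suc i + md l"] last[of "t + md l"] 2 by (cases "md l") auto
      ultimately show ?thesis using * by (metis order_refl)
    next
      case 3
      then show ?thesis using last[of "Suc i + md l"] by simp
    qed
  qed
  finally show ?case by simp
qed (auto simp: chain_model_def agree)

text \<open>The Horn argument shared by all four logics. By \<open>neg\<close>, a body true at point
  \<open>i\<close> is true throughout level \<open>i\<close>; by \<open>reached\<close>, the clause
  applies to each world there. A single head leaves no choice, so it holds throughout the level, and
  \<open>pos\<close> returns it to the chain. With two heads, different worlds could choose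
  differently.\<close>

lemma sat_chain_clauses:
  assumes "acc M \<subseteq> worlds M \<times> worlds M"
    and agree: "\<And>k. k \<le> t \<Longrightarrow> S k = level M w k"
    and upper: "\<And>i k n. (i, k) \<in> closure_for L {..t} (chain_rel loop t) \<Longrightarrow>
      S (k + n) \<subseteq> S (Suc i + n)"
    and last: "\<And>k. t < k \<Longrightarrow> S k = (if loop then S t else {})"
    and data: "horn_data (s, ns, ps)" and sat: "sat M w (clause (s, ns, ps))"
    and ne: "\<And>i. i \<le> t \<Longrightarrow> level M w i \<noteq> {}"
    and reached: "\<And>i. (0, i) \<in> closure_for L {..t} (chain_rel loop t) ^^ s \<Longrightarrow>
      level M w i \<subseteq> level M w s"
    and neg: "\<And>i l. (0, i) \<in> closure_for L {..t} (chain_rel loop t) ^^ s \<Longrightarrow> l \<in> set ns \<Longrightarrow>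
      level M w (i + md l) \<subseteq> S (i + md l)"
    and pos: "\<And>i l. (0, i) \<in> closure_for L {..t} (chain_rel loop t) ^^ s \<Longrightarrow> l \<in> set ps \<Longrightarrow>
      \<forall>v\<in>level M w (i + md l). sat M v (core l) \<Longrightarrow> \<forall>v\<in>S (i + md l). sat M v (core l)"
  shows "sat (chain_model L loop t M w) 0 (clause (s, ns, ps))"
proof -
  let ?C = "chain_model L loop t M w"
  have sub: "acc ?C \<subseteq> worlds ?C \<times> worlds ?C"
    using closure_for_subset[OF chain_rel_subset] by (simp add: chain_model_def)
  have lit: "sat ?C i l \<longleftrightarrow> (\<forall>v\<in>S (i + md l). sat M v (core l))"
    if "i \<le> t" "l \<in> set (ns @ ps)" for i l
    using sat_chain_literal[OF _ that(1) agree upper last] data that(2)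
    by (auto simp: horn_data_def)
  have lev: "(\<forall>v\<in>level M w i. sat M v l) \<longleftrightarrow> (\<forall>v\<in>level M w (i + md l). sat M v (core l))"
    if "l \<in> set (ns @ ps)" for i l
    using sat_level_literal[OF assms(1)] data that by (auto simp: horn_data_def)
  have "\<exists>l\<in>set ps. sat ?C i l"
    if i: "(0, i) \<in> closure_for L {..t} (chain_rel loop t) ^^ s" and ns: "\<forall>l\<in>set ns. sat ?C i l" for i
  proof -
    have "i \<le> t" using chain_closure_relpow(1)[OF i] .
    have "\<forall>v\<in>level M w i. sat M v l" if "l \<in> set ns" for l
      using ns lit[OF \<open>i \<le> t\<close>] lev neg[OF i that] that by fastforce
    then have ex: "\<exists>l\<in>set ps. sat M v l" if "v \<in> level M w i" for v
      using sat reached[OF i] that unfolding sat_clause[OF assms(1)] by blast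
    \<comment> \<open>A world in the level rules out an empty list of heads: the clause cannot have
      a false conclusion there.\<close>
    moreover obtain v where "v \<in> level M w i" using ne[OF \<open>i \<le> t\<close>] by auto
    ultimately obtain l where l: "ps = [l]"
      using data by (cases ps) (auto simp: horn_data_def)
    then have "\<forall>v\<in>level M w i. sat M v l" using ex by auto
    then have "sat ?C i l" using lit[OF \<open>i \<le> t\<close>] lev pos[OF i] l by simp
    then show ?thesis using l by simp
  qed
  then show ?thesis unfolding sat_clause[OF sub] by (simp add: chain_model_def)
qed

section \<open>Counting argument for the cut point\<close>

text \<open>Each \<open>i\<close> rules out only the \<open>d i\<close> points just below the threshold of \<open>P i\<close>.\<close>

lemma gap_exists:
  fixes P :: "'i \<Rightarrow> nat \<Rightarrow> bool" and d :: "'i \<Rightarrow> nat"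
  assumes "finite I" and up: "\<And>i k k'. i \<in> I \<Longrightarrow> a \<le> k \<Longrightarrow> k \<le> k' \<Longrightarrow> P i k \<Longrightarrow> P i k'"
  obtains t where "a \<le> t" "t \<le> a + (\<Sum>i\<in>I. d i)" "\<And>i. i \<in> I \<Longrightarrow> P i (t + d i) \<Longrightarrow> P i t"
proof -
  \<comment> \<open>The points that \<open>i\<close> rules out as a cut.\<close>
  define B where "B i = {t. a \<le> t \<and> P i (t + d i) \<and> \<not> P i t}" for i
  have B: "finite (B i) \<and> card (B i) \<le> d i" if i: "i \<in> I" for i
  proof (cases "B i = {}")
    case False
    define m where "m = (LEAST t. t \<in> B i)"
    have m: "m \<in> B i" using False unfolding m_def by (metis LeastI equals0I)
    \<comment> \<open>At the least bad point \<open>m\<close>, \<open>P i\<close> holds at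
      \<open>m + d i\<close>, hence from there on, which leaves no bad point at or above
      \<open>m + d i\<close>.\<close>
    have "B i \<subseteq> {m..<m + d i}"
    proof
      fix t assume t: "t \<in> B i"
      then have "m \<le> t" unfolding m_def by (rule Least_le)
      moreover have "t < m + d i"
      proof (rule ccontr)
        assume "\<not> t < m + d i"
        then have "P i t" using up[OF i, of "m + d i" t] m by (auto simp: B_def)
        then show False using t by (simp add: B_def)
      qed
      ultimately show "t \<in> {m..<m + d i}" by simp
    qed
    then show ?thesis
      using card_mono[of "{m..<m + d i}" "B i"] finite_subset by auto
  qed simp
  \<comment> \<open>The interval of candidates has one element more than the bound on all bad points
    together.\<close>
  have "card (\<Union>i\<in>I. B i) \<le> (\<Sum>i\<in>I. card (B i))" by (rule card_UN_le[OF assms(1)])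
  also have "\<dots> \<le> (\<Sum>i\<in>I. d i)" using B by (intro sum_mono) auto
  finally have "card (\<Union>i\<in>I. B i) < card {a..a + (\<Sum>i\<in>I. d i)}" by simp
  then have "\<not> {a..a + (\<Sum>i\<in>I. d i)} \<subseteq> (\<Union>i\<in>I. B i)"
    using card_mono[of "\<Union>i\<in>I. B i"] B assms(1) by (metis finite_UN_I leD)
  then obtain t where "t \<in> {a..a + (\<Sum>i\<in>I. d i)}" "t \<notin> (\<Union>i\<in>I. B i)" by blast
  then show ?thesis using that[of t] by (auto simp: B_def)
qed

section \<open>Levels under the frame conditions\<close>

text \<open>Supplies the length of the chain: it stops at the bound \<open>D\<close> or just before
  the first empty level.\<close>

lemma last_level:
  obtains t where "t \<le> D" "\<And>i. i \<le> t \<Longrightarrow> level M w i \<noteq> {}" "t = D \<or> level M w (Suc t) = {}"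
proof -
  have "\<exists>t\<le>D. (\<forall>i\<le>t. level M w i \<noteq> {}) \<and> (t = D \<or> level M w (Suc t) = {})"
  proof (induction D)
    case (Suc D)
    then obtain t where t: "t \<le> D" "\<forall>i\<le>t. level M w i \<noteq> {}" "t = D \<or> level M w (Suc t) = {}"
      by blast
    show ?case
    proof (cases "level M w (Suc t) = {}")
      case True
      then show ?thesis using t by (intro exI[of _ t]) auto
    next
      case False
      then have "t = D" using t(3) by blast
      then have "\<forall>i\<le>Suc D. level M w i \<noteq> {}" using t(2) False by (metis le_Suc_eq)
      then show ?thesis by blast
    qed
  qed auto
  then show ?thesis using that by blast
qed

lemma level_empty:
  assumes "level M w k = {}" "k \<le> n"
  shows "level M w n = {}"
  using assms(2,1) by (induction rule: dec_induct) auto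

text \<open>A path can be prolonged by staying at its last world.\<close>

lemma level_refl_mono:
  assumes "acc M \<subseteq> worlds M \<times> worlds M" "refl_on (worlds M) (acc M)" "w \<in> worlds M" "i \<le> k"
  shows "level M w i \<subseteq> level M w k"
proof -
  have "level M w n \<subseteq> worlds M" for n
    using assms(1,3) by (induction n) auto
  then have "level M w n \<subseteq> level M w (Suc n)" for n
    using assms(2) by (fastforce simp: refl_on_def)
  then show ?thesis using lift_Suc_mono_le[of "level M w", OF _ assms(4)] by blast
qed

text \<open>Transitivity merges two steps into one. Level \<open>0\<close> is just
  \<open>{w}\<close> and need not contain the later levels, hence \<open>1 \<le> i\<close>.\<close>

lemma level_trans_antimono:
  assumes "trans (acc M)" "1 \<le> i" "i \<le> k"
  shows "level M w k \<subseteq> level M w i"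
  using assms(3)
proof (induction rule: dec_induct)
  case (step n)
  then obtain m where "n = Suc m" using assms(2) by (cases n) auto
  then have "level M w (Suc n) \<subseteq> level M w n" using assms(1) by (auto dest: transD)
  then show ?case using step.IH by blast
qed simp

lemma sat_horn_clause:
  assumes "\<phi> = conj_list (map clause cs)" "\<And>c. c \<in> set cs \<Longrightarrow> sat M w (clause c)"
  shows "sat M w \<phi>"
  using assms by (auto simp: sat_conj_list)

section \<open>The collapse for each logic\<close>

text \<open>A clause is evaluated exactly at level \<open>s\<close>, so its literals reach no
  further than \<open>md \<phi>\<close>. If the chain is shorter than that, the levels beyond it are
  empty, matching its dead end.\<close>

lemma horn_K:
  assumes "acc M \<subseteq> worlds M \<times> worlds M"
    and data: "\<forall>c\<in>set cs. horn_data c" and \<phi>: "\<phi> = conj_list (map clause cs)"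
    and sat: "sat M w \<phi>"
  obtains t where "t \<le> md \<phi>" "sat (chain_model K False t M w) 0 \<phi>"
proof -
  obtain t where t: "t \<le> md \<phi>" "\<And>i. i \<le> t \<Longrightarrow> level M w i \<noteq> {}"
    "t = md \<phi> \<or> level M w (Suc t) = {}"
    using last_level[of "md \<phi>" M w] by blast
  let ?S = "\<lambda>k. if k \<le> t then level M w k else {}"
  have "sat (chain_model K False t M w) 0 (clause c)" if c: "c \<in> set cs" for c
  proof (cases c)
    case (fields s ns ps)
    have S: "?S (i + md l) = level M w (i + md l)"
      if "(0, i) \<in> closure_for K {..t} (chain_rel False t) ^^ s" "l \<in> set ns \<union> set ps" for i l
    proof -
      have "i = s" using chain_closure_relpow(3)[OF that(1)] by simp
      then have "i + md l \<le> md \<phi>"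
        using md_clause[OF that(2), of s] md_conj_list[of "clause c" "map clause cs"] c \<phi> fields
        by simp
      then have "level M w (i + md l) = {}" if "t < i + md l"
        using t(3) that by (metis Suc_leI leD level_empty)
      then show ?thesis by (cases "i + md l \<le> t") simp_all
    qed
    have hd: "horn_data (s, ns, ps)" and sc: "sat M w (clause (s, ns, ps))"
      using data c fields sat \<phi> by (auto simp: sat_conj_list)
    show ?thesis unfolding fields
    proof (rule sat_chain_clauses[where S = ?S])
      show "?S (k + n) \<subseteq> ?S (Suc i + n)"
        if "(i, k) \<in> closure_for K {..t} (chain_rel False t)" for i k n
        using chain_closure_step(3)[OF that] by simp
    next
      show "level M w i \<subseteq> level M w s"
        if "(0, i) \<in> closure_for K {..t} (chain_rel False t) ^^ s" for i
        using chain_closure_relpow(3)[OF that] by simp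
    next
      show "level M w (i + md l) \<subseteq> ?S (i + md l)"
        if "(0, i) \<in> closure_for K {..t} (chain_rel False t) ^^ s" "l \<in> set ns" for i l
        using S that by blast
    next
      show "\<forall>v\<in>?S (i + md l). sat M v (core l)"
        if "(0, i) \<in> closure_for K {..t} (chain_rel False t) ^^ s" "l \<in> set ps"
          "\<forall>v\<in>level M w (i + md l). sat M v (core l)" for i l
        using that(3) by auto
    qed (use assms(1) hd sc t(2) in simp_all)
  qed
  then show ?thesis by (intro that[OF t(1)] sat_horn_clause[OF \<phi>])
qed

text \<open>Paths of \<open>s\<close> steps end at some \<open>i \<le> s\<close>, so
  \<open>i + md l\<close> stays within \<open>md \<phi>\<close> and clamping at the last point is
  never noticed. The loop is part of the reflexive closure anyway.\<close>

lemma horn_T: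
  assumes "acc M \<subseteq> worlds M \<times> worlds M" "refl_on (worlds M) (acc M)" "w \<in> worlds M"
    and data: "\<forall>c\<in>set cs. horn_data c" and \<phi>: "\<phi> = conj_list (map clause cs)"
    and sat: "sat M w \<phi>"
  shows "sat (chain_model T True (md \<phi>) M w) 0 \<phi>"
proof -
  let ?t = "md \<phi>"
  let ?A = "closure_for T {..?t} (chain_rel True ?t)"
  let ?S = "\<lambda>k. level M w (min ?t k)"
  note mono = level_refl_mono[OF assms(1-3)]
  have "w \<in> level M w i" for i using mono[of 0 i] by auto
  then have ne: "level M w i \<noteq> {}" for i by blast
  have "sat (chain_model T True ?t M w) 0 (clause c)" if c: "c \<in> set cs" for c
  proof (cases c)
    case (fields s ns ps)
    have S: "?S (i + md l) = level M w (i + md l)"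
      if "(0, i) \<in> ?A ^^ s" "l \<in> set ns \<union> set ps" for i l
    proof -
      have "i \<le> s" using chain_closure_relpow(4)[OF that(1)] by simp
      then have "i + md l \<le> md \<phi>"
        using md_clause[OF that(2), of s] md_conj_list[of "clause c" "map clause cs"] c \<phi> fields
        by simp
      then show ?thesis by (simp add: min_absorb2)
    qed
    have hd: "horn_data (s, ns, ps)" and sc: "sat M w (clause (s, ns, ps))"
      using data c fields sat \<phi> by (auto simp: sat_conj_list)
    show ?thesis unfolding fields
    proof (rule sat_chain_clauses[where S = ?S])
      show "?S (k + n) \<subseteq> ?S (Suc i + n)" if "(i, k) \<in> ?A" for i k n
        using chain_closure_step(4)[OF that] by (intro mono) auto
    next
      show "level M w i \<subseteq> level M w s" if "(0, i) \<in> ?A ^^ s" for i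
        using chain_closure_relpow(4)[OF that] mono by blast
    next
      show "level M w (i + md l) \<subseteq> ?S (i + md l)" if "(0, i) \<in> ?A ^^ s" "l \<in> set ns" for i l
        using S that by blast
    next
      show "\<forall>v\<in>?S (i + md l). sat M v (core l)"
        if "(0, i) \<in> ?A ^^ s" "l \<in> set ps" "\<forall>v\<in>level M w (i + md l). sat M v (core l)" for i l
        using S that by blast
    qed (use assms(1) hd sc ne in simp_all)
  qed
  then show ?thesis by (rule sat_horn_clause[OF \<phi>])
qed

text \<open>Levels grow by reflexivity and, from level \<open>1\<close> on, shrink by transitivity,
  so all levels from \<open>1\<close> on coincide. A cut at any positive point loses
  nothing.\<close>

lemma horn_S4:
  assumes "acc M \<subseteq> worlds M \<times> worlds M" "refl_on (worlds M) (acc M)" "trans (acc M)"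
    "w \<in> worlds M"
    and data: "\<forall>c\<in>set cs. horn_data c" and \<phi>: "\<phi> = conj_list (map clause cs)"
    and sat: "sat M w \<phi>"
  shows "sat (chain_model S4 True (md \<phi>) M w) 0 \<phi>"
proof -
  let ?t = "md \<phi>"
  let ?A = "closure_for S4 {..?t} (chain_rel True ?t)"
  let ?S = "\<lambda>k. level M w (min ?t k)"
  note mono = level_refl_mono[OF assms(1,2,4)]
  have top: "level M w i \<subseteq> level M w k" if "1 \<le> k" for i k
    using mono[of i "max i k"] level_trans_antimono[OF assms(3) that, of "max i k" w] by auto
  have "w \<in> level M w i" for i using mono[of 0 i] by auto
  then have ne: "level M w i \<noteq> {}" for i by blast
  have "sat (chain_model S4 True ?t M w) 0 (clause c)" if c: "c \<in> set cs" for c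
  proof (cases c)
    case (fields s ns ps)
    have S: "?S (i + md l) = level M w (i + md l)"
      if "(0, i) \<in> ?A ^^ s" "l \<in> set ns \<union> set ps" for i l
    \<comment> \<open>If the chain is a single point, clamping would send positive indices to level
      \<open>0\<close>; then \<open>i\<close> and \<open>md l\<close> both vanish.\<close>
    proof (cases "?t = 0 \<or> i + md l = 0")
      case True
      have "md l \<le> md \<phi>"
        using md_clause[OF that(2), of s] md_conj_list[of "clause c" "map clause cs"] c \<phi> fields
        by simp
      then show ?thesis using True chain_closure_relpow(1)[OF that(1)] by auto
    next
      case False
      then show ?thesis by (intro equalityI top) auto
    qed
    have hd: "horn_data (s, ns, ps)" and sc: "sat M w (clause (s, ns, ps))"
      using data c fields sat \<phi> by (auto simp: sat_conj_list)
    show ?thesis unfolding fields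
    proof (rule sat_chain_clauses[where S = ?S])
      show "?S (k + n) \<subseteq> ?S (Suc i + n)" if "(i, k) \<in> ?A" for i k n
      proof (cases "?t = 0")
        case False
        then show ?thesis by (intro top) auto
      qed simp
    next
      show "level M w i \<subseteq> level M w s" if "(0, i) \<in> ?A ^^ s" for i
        using chain_closure_relpow(2)[OF that] top[of s i] by (cases "s = 0") auto
    next
      show "level M w (i + md l) \<subseteq> ?S (i + md l)" if "(0, i) \<in> ?A ^^ s" "l \<in> set ns" for i l
        using S that by blast
    next
      show "\<forall>v\<in>?S (i + md l). sat M v (core l)"
        if "(0, i) \<in> ?A ^^ s" "l \<in> set ps" "\<forall>v\<in>level M w (i + md l). sat M v (core l)" for i l
        using S that by blast
    qed (use assms(1) hd sc ne in simp_all)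
  qed
  then show ?thesis by (rule sat_horn_clause[OF \<phi>])
qed

text \<open>When the levels run out, \<open>S\<close> can be the levels themselves: nothing is
  truncated, so bodies and heads transfer unchanged.\<close>

lemma horn_K4_cut:
  assumes "acc M \<subseteq> worlds M \<times> worlds M" "trans (acc M)"
    and data: "\<forall>c\<in>set cs. horn_data c" and \<phi>: "\<phi> = conj_list (map clause cs)"
    and sat: "sat M w \<phi>"
    and ne: "\<And>i. i \<le> t \<Longrightarrow> level M w i \<noteq> {}" and "level M w (Suc t) = {}"
  shows "sat (chain_model K4 False t M w) 0 \<phi>"
proof -
  let ?A = "closure_for K4 {..t} (chain_rel False t)"
  note anti = level_trans_antimono[OF assms(2)]
  have "sat (chain_model K4 False t M w) 0 (clause c)" if c: "c \<in> set cs" for c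
  proof (cases c)
    case (fields s ns ps)
    have hd: "horn_data (s, ns, ps)" and sc: "sat M w (clause (s, ns, ps))"
      using data c fields sat \<phi> by (auto simp: sat_conj_list)
    show ?thesis unfolding fields
    proof (rule sat_chain_clauses[where S = "level M w"])
      show "level M w (k + n) \<subseteq> level M w (Suc i + n)" if "(i, k) \<in> ?A" for i k n
        using chain_closure_step(5)[OF that] by (intro anti) auto
    next
      show "level M w i \<subseteq> level M w s" if "(0, i) \<in> ?A ^^ s" for i
        using chain_closure_relpow(2,5)[OF that] anti[of s i] by (cases "s = 0") auto
    next
      show "level M w k = (if False then level M w t else {})" if "t < k" for k
        using level_empty[OF assms(7), of k] that by simp
    qed (use assms(1) hd sc ne in simp_all)
  qed
  then show ?thesis by (rule sat_horn_clause[OF \<phi>])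
qed

text \<open>The levels last too long to be kept, so those after \<open>t\<close> are replaced by
  level \<open>t\<close>. Bodies only become harder to satisfy, as levels decrease; heads survive by
  the choice of \<open>t\<close>.\<close>

lemma horn_K4_loop:
  assumes "acc M \<subseteq> worlds M \<times> worlds M" "trans (acc M)"
    and data: "\<forall>c\<in>set cs. horn_data c" and \<phi>: "\<phi> = conj_list (map clause cs)"
    and sat: "sat M w \<phi>"
    and ne: "\<And>i. i < symbols \<phi> \<Longrightarrow> level M w i \<noteq> {}"
  obtains t where "t < symbols \<phi>" "sat (chain_model K4 True t M w) 0 \<phi>"
proof -
  note anti = level_trans_antimono[OF assms(2)]
  \<comment> \<open>The sum dominates every prefix, so \<open>a \<le> t\<close> puts the loop at or
    beyond each \<open>s\<close>; as a sum it combines with \<open>d\<close> clause by clause in the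
    size bound.\<close>
  define a where "a = (\<Sum>(s, ns, ps)\<in>set cs. s)"
  define P where "P = (\<lambda>(s :: nat, ns :: 'b fm list, ps) k. \<forall>l\<in>set ps. \<forall>v\<in>level M w k. sat M v (core l))"
  define d where "d = (\<lambda>(s :: nat, ns :: 'b fm list, ps). \<Sum>l\<leftarrow>ps. md (l :: 'b fm))"
  have s_le: "s \<le> a" if "(s, ns, ps) \<in> set cs" for s ns ps
    using member_le_sum[OF that, of "\<lambda>(s, ns, ps). s"] unfolding a_def by auto
  \<comment> \<open>The condition for \<open>t = 0\<close> guards against clamping a later level to
    the root, where antitonicity fails.\<close>
  obtain t where t: "t < symbols \<phi>" "a \<le> t" "t = 0 \<Longrightarrow> md \<phi> = 0"
    and gap: "a = 0 \<and> t = md \<phi> \<or> (\<forall>c\<in>set cs. P c (t + d c) \<longrightarrow> P c t)"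
  proof (cases "a = 0")
    \<comment> \<open>No clause is boxed, so only the root and levels up to the modal depth matter.\<close>
    case True
    then show ?thesis using that[of "md \<phi>"] md_less_symbols[of \<phi>] by simp
  next
    case False
    \<comment> \<open>Here \<open>a\<close> is positive, so the levels from \<open>a\<close> on
      decrease and a head true on one stays true on the later ones.\<close>
    have up: "P c k'" if "P c k" "a \<le> k" "k \<le> k'" for c k k'
    proof -
      have "level M w k' \<subseteq> level M w k" using anti[of k k'] that False by simp
      then show ?thesis using that(1) unfolding P_def by (cases c) auto
    qed
    obtain t where t: "a \<le> t" "t \<le> a + (\<Sum>c\<in>set cs. d c)"
      "\<And>c. c \<in> set cs \<Longrightarrow> P c (t + d c) \<Longrightarrow> P c t"
      using gap_exists[where I = "set cs" and P = P and d = d and a = a] up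
      by (metis List.finite_set)
    have "cs \<noteq> []" using False by (auto simp: a_def)
    have "a + (\<Sum>c\<in>set cs. d c) = (\<Sum>c\<in>set cs. fst c + d c)"
      by (simp add: a_def sum.distrib case_prod_beta)
    also have "\<dots> < (\<Sum>c\<in>set cs. symbols (clause c))"
    proof (intro sum_strict_mono)
      show "fst c + d c < symbols (clause c)" if "c \<in> set cs" for c
      proof (cases c)
        case (fields s ns ps)
        then have "length ps \<le> 1" using data that by (auto simp: horn_data_def)
        then show ?thesis using symbols_clause[of ps s ns] fields by (simp add: d_def)
      qed
    qed (use \<open>cs \<noteq> []\<close> in auto)
    also have "\<dots> \<le> (\<Sum>c\<leftarrow>cs. symbols (clause c))"
      by (rule sum_set_le_sum_list)
    also have "\<dots> \<le> symbols \<phi>"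
      using symbols_conj_list[of "map clause cs"] \<phi> by (simp add: comp_def)
    finally show ?thesis using that[of t] t False by auto
  qed
  let ?A = "closure_for K4 {..t} (chain_rel True t)"
  let ?S = "\<lambda>k. level M w (min t k)"
  have clamp: "level M w k \<subseteq> ?S k" if "t = 0 \<Longrightarrow> k = 0" for k
  proof (cases "k = 0")
    case False
    moreover have "t \<noteq> 0" using that False by blast
    ultimately show ?thesis by (intro anti) auto
  qed simp
  have "sat (chain_model K4 True t M w) 0 (clause c)" if c: "c \<in> set cs" for c
  proof (cases c)
    case (fields s ns ps)
    have "s \<le> t" using s_le[of s ns ps] c fields t(2) by simp
    have md: "s + md l \<le> md \<phi>" if "l \<in> set ns \<union> set ps" for l
      using md_clause[OF that, of s] md_conj_list[of "clause c" "map clause cs"] c \<phi> fields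
      by simp
    have hd: "horn_data (s, ns, ps)" and sc: "sat M w (clause (s, ns, ps))"
      using data c fields sat \<phi> by (auto simp: sat_conj_list)
    show ?thesis unfolding fields
    proof (rule sat_chain_clauses[where S = ?S])
      show "?S (k + n) \<subseteq> ?S (Suc i + n)" if "(i, k) \<in> ?A" for i k n
      proof (cases "t = 0")
        case False
        then show ?thesis using chain_closure_step(5)[OF that] by (intro anti) auto
      qed simp
    next
      show "level M w i \<subseteq> level M w s" if "(0, i) \<in> ?A ^^ s" for i
        using chain_closure_relpow(2,5)[OF that] anti[of s i w] \<open>s \<le> t\<close> by (cases "s = 0") auto
    next
      show "level M w (i + md l) \<subseteq> ?S (i + md l)" if "(0, i) \<in> ?A ^^ s" "l \<in> set ns" for i l
        using that md[of l] t(3) chain_closure_relpow(1)[OF that(1)] by (intro clamp) auto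
    next
      fix i l assume i: "(0, i) \<in> ?A ^^ s" and l: "l \<in> set ps"
        and holds: "\<forall>v\<in>level M w (i + md l). sat M v (core l)"
      show "\<forall>v\<in>?S (i + md l). sat M v (core l)"
      proof (cases "i + md l \<le> t")
        case False
        have "i \<le> t" using chain_closure_relpow(1)[OF i] .
        have "t \<noteq> 0" using False \<open>i \<le> t\<close> md[of l] l t(3) by auto
        have "s = 0 \<Longrightarrow> i = 0" using chain_closure_relpow(2)[OF i] .
        \<comment> \<open>If \<open>a = 0\<close>, then \<open>s = 0\<close> and
          \<open>i = 0\<close>, and a cut at \<open>md \<phi>\<close> would give
          \<open>i + md l \<le> t\<close>.\<close>
        then have "\<not> (a = 0 \<and> t = md \<phi>)"
          using False md[of l] l s_le[of s ns ps] c fields by auto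
        then have "P c (t + d c) \<longrightarrow> P c t" using gap c by blast
        moreover have "ps = [l]"
          using data c fields l by (cases ps) (auto simp: horn_data_def)
        ultimately have "(\<forall>v\<in>level M w (t + md l). sat M v (core l)) \<longrightarrow>
            (\<forall>v\<in>level M w t. sat M v (core l))"
          by (simp add: P_def d_def fields)
        \<comment> \<open>The head holds at level \<open>i + md l\<close>, hence at the smaller
          level \<open>t + md l\<close>; the gap property brings it back to level \<open>t\<close>,
          which is the value of \<open>?S\<close> past the end.\<close>
        moreover have "level M w (t + md l) \<subseteq> level M w (i + md l)"
          using anti[of "i + md l" "t + md l" w] False \<open>i \<le> t\<close> by auto
        ultimately show ?thesis using holds False by (auto simp: min_def)
      qed (use holds in \<open>simp add: min_absorb2\<close>)
    qed (use assms(1) hd sc ne t(1) in simp_all)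
  qed
  then show ?thesis by (intro that[OF t(1)] sat_horn_clause[OF \<phi>])
qed

section \<open>Assembly and transfer between world types\<close>

text \<open>The bounds concern the last index \<open>t\<close>; the chain has \<open>t + 1\<close>
  worlds, hence \<open>symbols \<phi> - 1\<close>.\<close>

lemma horn_chain:
  assumes "horn_box_formula \<phi>" "satisfiable TYPE('w) L \<phi>"
  obtains loop t and M :: "('w, 'p) model" and w where
    "t \<le> (if L = K \<or> L = T then md \<phi> else symbols \<phi> - 1)"
    "sat (chain_model L loop t M w) 0 \<phi>"
proof -
  obtain cs where cs: "\<forall>c\<in>set cs. horn_data c" "\<phi> = conj_list (map clause cs)"
    using horn_box_formula_data[OF assms(1)] .
  obtain M :: "('w, 'p) model" and w where M: "frame_class L (worlds M) (acc M)"
    "w \<in> worlds M" "sat M w \<phi>"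
    using assms(2) unfolding satisfiable_def satisfiable_in_def by blast
  have sub: "acc M \<subseteq> worlds M \<times> worlds M"
    using frame_class_is_frame[OF M(1)] by (simp add: is_frame_def)
  have md: "md \<phi> \<le> symbols \<phi> - 1" using md_less_symbols[of \<phi>] by simp
  show ?thesis
  proof (cases L)
    case K
    obtain t where "t \<le> md \<phi>" "sat (chain_model K False t M w) 0 \<phi>"
      using horn_K[OF sub cs M(3)] .
    then show ?thesis using K that[of t False M w] by simp
  next
    case T
    then show ?thesis using horn_T[OF sub _ M(2) cs M(3)] M(1) that[of "md \<phi>" True M w] by auto
  next
    case S4
    then show ?thesis using horn_S4[OF sub _ _ M(2) cs M(3)] M(1) that[of "md \<phi>" True M w] md
      by auto
  next
    case K4
    then have tr: "trans (acc M)" using M(1) by simp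
    obtain t where t: "t \<le> symbols \<phi> - 1" "\<And>i. i \<le> t \<Longrightarrow> level M w i \<noteq> {}"
      "t = symbols \<phi> - 1 \<or> level M w (Suc t) = {}"
      using last_level[of "symbols \<phi> - 1" M w] by blast
    show ?thesis
    proof (cases "level M w (Suc t) = {}")
      case True
      then show ?thesis
        using horn_K4_cut[OF sub tr cs M(3) t(2) True] t(1) K4 that[of t False M w] by simp
    next
      case False
      \<comment> \<open>With level \<open>Suc t\<close> nonempty, the chain was stopped by the
        bound, so \<open>t = symbols \<phi> - 1\<close>.\<close>
      then have "level M w i \<noteq> {}" if "i < symbols \<phi>" for i using t(2,3) that by auto
      then obtain t' where "t' < symbols \<phi>" "sat (chain_model K4 True t' M w) 0 \<phi>"
        using horn_K4_loop[OF sub tr cs M(3)] by blast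
      then show ?thesis using K4 that[of t' True M w] by auto
    qed
  qed
qed

lemma chain_model_transfer:
  assumes "sat (chain_model L loop t M w) 0 \<phi>"
  obtains N :: "('v::infinite, 'p) model" where "pre_linear_model L N" "finite (worlds N)"
    "card (worlds N) = t + 1" "satisfiable_in N \<phi>"
proof -
  obtain g :: "nat \<Rightarrow> 'v" where "inj g"
    using infinite_UNIV infinite_countable_subset by blast
  let ?C = "chain_model L loop t M w"
  have inj: "inj_on g (worlds ?C)" using \<open>inj g\<close> inj_on_subset by blast
  have "acc ?C \<subseteq> worlds ?C \<times> worlds ?C"
    using closure_for_subset[OF chain_rel_subset] by (simp add: chain_model_def)
  moreover have "satisfiable_in ?C \<phi>"
    using assms unfolding satisfiable_in_def by (intro bexI[of _ 0]) (auto simp: chain_model_def)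
  ultimately show ?thesis
    using that[of "image_model g ?C"] satisfiable_in_image_model[OF inj]
      pre_linear_model_image[OF inj pre_linear_model_chain] card_image[OF inj]
    by (simp add: image_model_def chain_model_def)
qed

theorem theorem4p3:
  fixes L :: logic and \<phi> :: "'p::countable fm"
  assumes "horn_box_formula \<phi>"
  shows "(L \<in> {K, T} \<longrightarrow>
           (satisfiable TYPE('w::infinite) L \<phi> \<longleftrightarrow>
             (\<exists>M :: ('v::infinite, 'p) model. pre_linear_model L M
                \<and> finite (worlds M) \<and> card (worlds M) \<le> md \<phi> + 1 \<and> satisfiable_in M \<phi>)))
       \<and> (L \<in> {K4, S4} \<longrightarrow>
           (satisfiable TYPE('w) L \<phi> \<longleftrightarrow>
             (\<exists>M :: ('v, 'p) model. pre_linear_model L M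
                \<and> finite (worlds M) \<and> card (worlds M) \<le> symbols \<phi> \<and> satisfiable_in M \<phi>)))"
proof -
  have "\<exists>N :: ('v, 'p) model. pre_linear_model L N \<and> finite (worlds N)
      \<and> card (worlds N) \<le> (if L = K \<or> L = T then md \<phi> else symbols \<phi> - 1) + 1
      \<and> satisfiable_in N \<phi>"
    if L_sat: "satisfiable TYPE('w) L \<phi>"
  proof -
    obtain loop t and M :: "('w, 'p) model" and w where
      t: "t \<le> (if L = K \<or> L = T then md \<phi> else symbols \<phi> - 1)" and
      sat: "sat (chain_model L loop t M w) 0 \<phi>"
      using horn_chain[OF assms L_sat] .
    obtain N :: "('v, 'p) model" where "pre_linear_model L N" "finite (worlds N)"
      "card (worlds N) = t + 1" "satisfiable_in N \<phi>"
      using chain_model_transfer[OF sat] .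
    then show ?thesis using t by (intro exI[of _ N]) auto
  qed
  \<comment> \<open>Truncated subtraction is harmless because every formula has at least one
    symbol.\<close>
  moreover have "symbols \<phi> - 1 + 1 = symbols \<phi>" using md_less_symbols[of \<phi>] by simp
  ultimately show ?thesis using pre_linear_model_satisfiable[where 'v = 'v and 'w = 'w] by auto
qed

end
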